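(* Let $K$ be a field, let $n_1<n_2<n_3<n_4$ be positive integers with $\gcd(n_1,n_2,n_3,n_4)=1$, and let $C$ be the monomial curve $x_i=t^{n_i}$ ($1\le i\le 4$) in $\mathbb{A}^4(K)$. Assume that $C$ is Gorenstein and not a complete intersection, that $C$ has Cohen-Macaulay tangent cone at the origin, and that $I(C)$ is minimally generated by $$f_1=x_1^{a_1}-x_2^{a_{12}}x_3^{a_{13}},\quad f_2=x_2^{a_2}-x_1^{a_{21}}x_4^{a_{24}},\quad f_3=x_3^{a_3}-x_2^{a_{32}}x_4^{a_{34}},$$ $$f_4=x_4^{a_4}-x_1^{a_{41}}x_3^{a_{43}},\quad f_5=x_1^{a_{41}}x_2^{a_{32}}-x_3^{a_{13}}x_4^{a_{24}},$$ where $a_i>1$ and $0<a_{ij}<a_j$ for all the exponents appearing. Suppose that $a_3>a_{32}+a_{34}$, $a_{34}<a_{24}$ and $a_{12}\le a_{32}$. If $a_2\le a_{21}+a_{24}$ and $a_3+a_{13}\le a_1+a_{32}-a_{12}+a_{34}$, then $I(C)_*$ is minimally generated by the six polynomials $$G_*=\{x_2^{a_{12}}x_3^{a_{13}},\ p_2,\ x_2^{a_{32}}x_4^{a_{34}},\ x_4^{a_4},\ x_3^{a_{13}}x_4^{a_{24}},\ p_6\},$$ where $p_2=x_2^{a_2}$ if $a_2<a_{21}+a_{24}$ and $p_2=x_2^{a_2}-x_1^{a_{21}}x_4^{a_{24}}$ if $a_2=a_{21}+a_{24}$; $p_6=x_3^{a_3+a_{13}}$ if $a_3+a_{13}<a_1+a_{32}-a_{12}+a_{34}$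 and $p_6=x_3^{a_3+a_{13}}-x_1^{a_1}x_2^{a_{32}-a_{12}}x_4^{a_{34}}$ if $a_3+a_{13}=a_1+a_{32}-a_{12}+a_{34}$.
   Context: $I(C)$ is the kernel of the $K$-algebra homomorphism $\phi:K[x_1,\ldots,x_4]\to K[t]$, $\phi(x_i)=t^{n_i}$. $C$ is Gorenstein when the numerical semigroup generated by $n_1,\ldots,n_4$ is symmetric, and it is not a complete intersection when $I(C)$ cannot be generated by three elements. For $0\ne f\in I(C)$, $f_*$ denotes the homogeneous summand of $f$ of least (standard) degree, and $I(C)_*$ is the ideal of $K[x_1,\ldots,x_4]$ generated by all $f_*$, $f\in I(C)$; it is the defining ideal of the tangent cone of $C$ at the origin. $C$ has Cohen-Macaulay tangent cone at the origin if $K[x_1,\ldots,x_4]/I(C)_*$ is Cohen-Macaulay. In the described situation the exponents satisfy (Bresinsky) $a_1=a_{21}+a_{41}$, $a_2=a_{12}+a_{32}$, $a_3=a_{13}+a_{43}$, $a_4=a_{24}+a_{34}$. *)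

theory Defs
  imports
    "HOL-Library.Poly_Mapping"
    "HOL-Library.Numeral_Type"
    "HOL-Library.Extended_Nat"
    "HOL-Computational_Algebra.Polynomial"
    "HOL-Algebra.QuotRing"
    "HOL-Algebra.Ring_Divisibility"
    "HOL-Algebra.Algebraic_Closure_Type"
begin

section \<open>Cohen-Macaulay rings\<close>

text \<open>The height (codimension) of a prime ideal: the supremum of the lengths of chains
  of primes ending in it; a chain of \<open>k + 1\<close> primes has length \<open>k\<close>.\<close>

definition prime_height :: "('a, 'b) ring_scheme \<Rightarrow> 'a set \<Rightarrow> enat" where
  "prime_height R P =
     Sup {enat (length Ps - 1) | Ps. Ps \<noteq> [] \<and> last Ps = P \<and>
            (\<forall>Q \<in> set Ps. primeideal Q R) \<and> sorted_wrt (\<subset>) Ps}"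

definition regular_sequence :: "('a, 'b) ring_scheme \<Rightarrow> 'a list \<Rightarrow> bool" where
  "regular_sequence R xs \<longleftrightarrow>
     set xs \<subseteq> carrier R \<and>
     Idl\<^bsub>R\<^esub> (set xs) \<noteq> carrier R \<and>
     (\<forall>i < length xs. \<forall>r \<in> carrier R.
        (xs ! i) \<otimes>\<^bsub>R\<^esub> r \<in> Idl\<^bsub>R\<^esub> (set (take i xs)) \<longrightarrow> r \<in> Idl\<^bsub>R\<^esub> (set (take i xs)))"

definition ideal_depth :: "('a, 'b) ring_scheme \<Rightarrow> 'a set \<Rightarrow> enat" where
  "ideal_depth R I = Sup {enat (length xs) | xs. regular_sequence R xs \<and> set xs \<subseteq> I}"

text \<open>This is the definition of Eisenbud, Commutative Algebra with a View Toward Algebraic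
  Geometry, Section 18.2: \<open>depth M = codim M\<close> for every maximal ideal \<open>M\<close>. Both sides agree
  with the depth and the dimension of the localization at \<open>M\<close>.\<close>

definition cohen_macaulay :: "('a, 'b) ring_scheme \<Rightarrow> bool" where
  "cohen_macaulay R \<longleftrightarrow>
     cring R \<and> noetherian_ring R \<and>
     (\<forall>M. maximalideal M R \<longrightarrow> ideal_depth R M = prime_height R M)"


section \<open>The polynomial ring in four variables\<close>

text \<open>In the index type \<open>4\<close> the numerals \<open>1, 2, 3, 4\<close> are pairwise distinct and exhaust the
  type (with \<open>4 = 0\<close>), so they serve as the indices of the variables.\<close>

type_synonym 'k poly4 = "(4 \<Rightarrow>\<^sub>0 nat) \<Rightarrow>\<^sub>0 'k"

abbreviation poly4_ring :: "'k::field poly4 ring" where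
  "poly4_ring \<equiv> ring_of_type_algebra"

definition Var :: "4 \<Rightarrow> 'k::field poly4" where
  "Var i = Poly_Mapping.single (Poly_Mapping.single i 1) 1"

definition ideal_gen :: "'k::field poly4 set \<Rightarrow> 'k poly4 set" where
  "ideal_gen G = Idl\<^bsub>poly4_ring\<^esub> G"

definition minimally_generates :: "'k::field poly4 set \<Rightarrow> 'k poly4 set \<Rightarrow> bool" where
  "minimally_generates G I \<longleftrightarrow> ideal_gen G = I \<and> (\<forall>H. H \<subset> G \<longrightarrow> ideal_gen H \<noteq> I)"


section \<open>Tangent cones\<close>

definition total_degree :: "(4 \<Rightarrow>\<^sub>0 nat) \<Rightarrow> nat" where
  "total_degree m = (\<Sum>i\<in>UNIV. Poly_Mapping.lookup m i)"

definition homogeneous_summand :: "nat \<Rightarrow> 'k::field poly4 \<Rightarrow> 'k poly4" where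
  "homogeneous_summand d f =
     (\<Sum>m \<in> {m \<in> Poly_Mapping.keys f. total_degree m = d}.
        Poly_Mapping.single m (Poly_Mapping.lookup f m))"

definition initial_form :: "'k::field poly4 \<Rightarrow> 'k poly4" where
  "initial_form f = homogeneous_summand (LEAST d. homogeneous_summand d f \<noteq> 0) f"

definition initial_ideal :: "'k::field poly4 set \<Rightarrow> 'k poly4 set" where
  "initial_ideal I = ideal_gen {initial_form f | f. f \<in> I \<and> f \<noteq> 0}"

definition cm_tangent_cone :: "'k::field poly4 set \<Rightarrow> bool" where
  "cm_tangent_cone I \<longleftrightarrow> cohen_macaulay (poly4_ring Quot initial_ideal I)"


section \<open>Monomial curves\<close>

text \<open>The \<open>K\<close>-algebra homomorphism \<open>K[x\<^sub>1, \<dots>, x\<^sub>4] \<rightarrow> K[t]\<close> with \<open>x\<^sub>i \<mapsto> t\<^bsup>n i\<^esup>\<close>.\<close>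

definition curve_hom :: "(4 \<Rightarrow> nat) \<Rightarrow> 'k::field poly4 \<Rightarrow> 'k poly" where
  "curve_hom n f =
     (\<Sum>m \<in> Poly_Mapping.keys f.
        Polynomial.smult (Poly_Mapping.lookup f m)
          (\<Prod>i\<in>UNIV. (Polynomial.monom 1 (n i)) ^ Poly_Mapping.lookup m i))"

definition curve_ideal :: "(4 \<Rightarrow> nat) \<Rightarrow> 'k::field poly4 set" where
  "curve_ideal n = a_kernel poly4_ring ring_of_type_algebra (curve_hom n)"

definition numerical_semigroup :: "(4 \<Rightarrow> nat) \<Rightarrow> nat set" where
  "numerical_semigroup n = {(\<Sum>i\<in>UNIV. c i * n i) | c :: 4 \<Rightarrow> nat. True}"

text \<open>The Frobenius number is taken among the integers, so that it is \<open>-1\<close> for the semigroup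
  of all natural numbers. It is meaningful for semigroups with finite complement.\<close>

definition frobenius_number :: "nat set \<Rightarrow> int" where
  "frobenius_number S = (GREATEST z. z \<notin> int ` S)"

definition symmetric_semigroup :: "nat set \<Rightarrow> bool" where
  "symmetric_semigroup S \<longleftrightarrow>
     (\<forall>z. z \<in> int ` S \<longleftrightarrow> frobenius_number S - z \<notin> int ` S)"

definition gorenstein_curve :: "(4 \<Rightarrow> nat) \<Rightarrow> bool" where
  "gorenstein_curve n \<longleftrightarrow> symmetric_semigroup (numerical_semigroup n)"

definition complete_intersection :: "'k::field poly4 set \<Rightarrow> bool" where
  "complete_intersection I \<longleftrightarrow> (\<exists>g1 g2 g3. ideal_gen {g1, g2, g3} = I)"

end

theory Submission
  imports Defs "HOL-Analysis.Cartesian_Space"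
begin

text \<open>Since \<open>I(C)\<close> is spanned by binomials \<open>x\<^sup>u - x\<^sup>v\<close> with \<open>u\<close> and \<open>v\<close> of the same weight
  \<open>\<Sum> n\<^sub>i u\<^sub>i\<close>, its initial ideal is spanned by the monomials \<open>x\<^sup>u\<close> for which some \<open>v\<close> of the same
  weight has larger degree, and by the homogeneous binomials of that kind. The generators
  \<open>f\<^sub>1, \<dots>, f\<^sub>5\<close>, together with \<open>x\<^sub>3\<^bsup>a\<^sub>3 + a\<^sub>1\<^sub>3\<^esup> - x\<^sub>1\<^bsup>a\<^sub>1\<^esup> x\<^sub>2\<^bsup>a\<^sub>3\<^sub>2 - a\<^sub>1\<^sub>2\<^esup> x\<^sub>4\<^bsup>a\<^sub>3\<^sub>4\<^esup>\<close>, give six weight-preserving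
  rewriting rules which never lower the degree. Every monomial can be rewritten to one to which no
  rule applies, so the six initial forms generate the initial ideal as soon as distinct irreducible
  monomials have distinct weights. That in turn follows from the fact that a monomial which is not
  alone in its weight is divisible by a monomial of one of the \<open>f\<^sub>i\<close>.\<close>

section \<open>Ideals of the polynomial ring\<close>

lemma carrier_poly4 [simp]: "carrier poly4_ring = UNIV"
  and mult_poly4 [simp]: "f \<otimes>\<^bsub>poly4_ring\<^esub> g = f * g"
  and add_poly4 [simp]: "f \<oplus>\<^bsub>poly4_ring\<^esub> g = f + g"
  and zero_poly4 [simp]: "\<zero>\<^bsub>poly4_ring\<^esub> = 0"
  by (simp_all add: ring_of_type_algebra_def)

lemma cring_poly4: "cring (poly4_ring :: 'k::field poly4 ring)"
  by (rule cring_from_type_algebra)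

lemma ring_poly4: "ring (poly4_ring :: 'k::field poly4 ring)"
  by (rule ring_from_type_algebra)

lemma ideal_poly4I:
  fixes J :: "'k::field poly4 set"
  assumes "0 \<in> J" "\<And>f g. f \<in> J \<Longrightarrow> g \<in> J \<Longrightarrow> f + g \<in> J" "\<And>f h. f \<in> J \<Longrightarrow> h * f \<in> J"
  shows "ideal J poly4_ring"
proof (rule idealI)
  interpret cring "poly4_ring :: 'k poly4 ring" by (rule cring_poly4)
  show "ring (poly4_ring :: 'k poly4 ring)" by (rule ring_poly4)
  show "subgroup J (add_monoid poly4_ring)"
  proof (rule add.subgroupI)
    fix f assume "f \<in> J"
    then have "(-1) * f \<in> J" by (rule assms(3))
    moreover have "\<ominus>\<^bsub>poly4_ring\<^esub> f = - f"
      by (rule minus_equality) auto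
    ultimately show "\<ominus>\<^bsub>poly4_ring\<^esub> f \<in> J" by simp
  qed (use assms in auto)
qed (use assms in \<open>auto simp: mult.commute\<close>)

lemma
  fixes J :: "'k::field poly4 set"
  assumes "ideal J poly4_ring"
  shows ideal_poly4_zero: "0 \<in> J"
    and ideal_poly4_add: "f \<in> J \<Longrightarrow> g \<in> J \<Longrightarrow> f + g \<in> J"
    and ideal_poly4_mult: "f \<in> J \<Longrightarrow> h * f \<in> J"
    and ideal_poly4_diff: "f \<in> J \<Longrightarrow> g \<in> J \<Longrightarrow> f - g \<in> J"
proof -
  interpret ideal J poly4_ring by fact
  show "0 \<in> J" using additive_subgroup.zero_closed [OF additive_subgroup_axioms] by simp
  show add: "f + g \<in> J" if "f \<in> J" "g \<in> J" for f g
    using additive_subgroup.a_closed [OF additive_subgroup_axioms] that by simp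
  show mult: "h * f \<in> J" if "f \<in> J" for f h
    using I_l_closed that by simp
  show "f - g \<in> J" if "f \<in> J" "g \<in> J"
    using add [OF that(1) mult [OF that(2), of "-1"]] by simp
qed

lemma ideal_poly4_sum:
  fixes J :: "'k::field poly4 set"
  assumes "ideal J poly4_ring" "\<And>i. i \<in> A \<Longrightarrow> f i \<in> J"
  shows "sum f A \<in> J"
  using assms(2)
  by (induction A rule: infinite_finite_induct)
    (auto intro: ideal_poly4_zero ideal_poly4_add assms(1))

lemma ideal_ideal_gen: "ideal (ideal_gen G) poly4_ring"
  unfolding ideal_gen_def by (rule ring.genideal_ideal [OF ring_poly4]) simp

lemma ideal_gen_superset: "G \<subseteq> ideal_gen G"
  unfolding ideal_gen_def by (rule ring.genideal_self [OF ring_poly4]) simp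

lemma ideal_gen_minimal: "ideal J poly4_ring \<Longrightarrow> G \<subseteq> J \<Longrightarrow> ideal_gen G \<subseteq> J"
  unfolding ideal_gen_def by (rule ring.genideal_minimal [OF ring_poly4])

text \<open>The polynomials whose monomials are all multiples of monomials of generators form an
  ideal. Both \<open>fiber\<close> and the minimality of the generators rest on this.\<close>

lemma keys_ideal_gen:
  fixes f :: "'k::field poly4"
  assumes "f \<in> ideal_gen G" "m \<in> Poly_Mapping.keys f"
  obtains g d e where "g \<in> G" "d \<in> Poly_Mapping.keys g" "m = d + e"
proof -
  define D where "D = {d + e | d e. \<exists>g\<in>G. d \<in> Poly_Mapping.keys g}"
  have "ideal {f :: 'k poly4. Poly_Mapping.keys f \<subseteq> D} poly4_ring"
  proof (rule ideal_poly4I)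
    fix f h :: "'k poly4"
    assume f: "f \<in> {f. Poly_Mapping.keys f \<subseteq> D}"
    have "a + b \<in> D" if "b \<in> Poly_Mapping.keys f" for a b
    proof -
      have "b \<in> D" using that f by blast
      then obtain d e g where b: "b = d + e" and "g \<in> G" "d \<in> Poly_Mapping.keys g"
        unfolding D_def by blast
      moreover have "a + b = d + (a + e)" unfolding b by (simp add: ac_simps)
      ultimately show ?thesis unfolding D_def by blast
    qed
    then show "h * f \<in> {f. Poly_Mapping.keys f \<subseteq> D}"
      using keys_mult [of h f] by auto
  qed (use Poly_Mapping.keys_add in fastforce)+
  moreover have "G \<subseteq> {f. Poly_Mapping.keys f \<subseteq> D}"
    unfolding D_def by clarsimp (metis add.right_neutral)
  ultimately have "Poly_Mapping.keys f \<subseteq> D"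
    using ideal_gen_minimal assms(1) by blast
  then show thesis
    using assms(2) that unfolding D_def by blast
qed


section \<open>Monomials\<close>

abbreviation xm :: "(4 \<Rightarrow>\<^sub>0 nat) \<Rightarrow> 'k::field poly4" where
  "xm u \<equiv> Poly_Mapping.single u 1"

definition expo :: "nat \<Rightarrow> nat \<Rightarrow> nat \<Rightarrow> nat \<Rightarrow> 4 \<Rightarrow>\<^sub>0 nat" where
  "expo a b c d = Poly_Mapping.single 1 a + Poly_Mapping.single 2 b
     + Poly_Mapping.single 3 c + Poly_Mapping.single 4 d"

lemma lookup_expo [simp]:
  "Poly_Mapping.lookup (expo a b c d) 1 = a" "Poly_Mapping.lookup (expo a b c d) 2 = b"
  "Poly_Mapping.lookup (expo a b c d) 3 = c" "Poly_Mapping.lookup (expo a b c d) 4 = d"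
  by (simp_all add: expo_def lookup_add lookup_single)

lemma expo_cases: obtains a b c d where "m = expo a b c d"
proof
  show "m = expo (Poly_Mapping.lookup m 1) (Poly_Mapping.lookup m 2)
     (Poly_Mapping.lookup m 3) (Poly_Mapping.lookup m 4)"
    by (simp add: poly_mapping_eq_iff fun_eq_iff forall_4)
qed

lemma expo_eq_iff [simp]:
  "expo a b c d = expo a' b' c' d' \<longleftrightarrow> a = a' \<and> b = b' \<and> c = c' \<and> d = d'"
  by (metis lookup_expo)

lemma Var_power: "Var i ^ k = Poly_Mapping.single (Poly_Mapping.single i k) 1"
  by (induction k) (simp_all add: Var_def mult_single flip: single_add)

lemma Var_power_expo:
  "Var 1 ^ a = xm (expo a 0 0 0)" "Var 2 ^ b = xm (expo 0 b 0 0)"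
  "Var 3 ^ c = xm (expo 0 0 c 0)" "Var 4 ^ d = xm (expo 0 0 0 d)"
  by (simp_all add: Var_power expo_def)

lemma expo_add: "expo a b c d + expo a' b' c' d' = expo (a + a') (b + b') (c + c') (d + d')"
  by (simp add: poly_mapping_eq_iff fun_eq_iff forall_4 lookup_add)

definition mono_dvd :: "(4 \<Rightarrow>\<^sub>0 nat) \<Rightarrow> (4 \<Rightarrow>\<^sub>0 nat) \<Rightarrow> bool" where
  "mono_dvd d m \<longleftrightarrow> (\<exists>e. m = d + e)"

lemma mono_dvd_expo [simp]:
  "mono_dvd (expo a b c d) (expo a' b' c' d') \<longleftrightarrow> a \<le> a' \<and> b \<le> b' \<and> c \<le> c' \<and> d \<le> d'"
proof
  assume "mono_dvd (expo a b c d) (expo a' b' c' d')"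
  then obtain e where e: "expo a' b' c' d' = expo a b c d + e"
    unfolding mono_dvd_def by blast
  show "a \<le> a' \<and> b \<le> b' \<and> c \<le> c' \<and> d \<le> d'"
    using arg_cong [OF e, of "\<lambda>m. Poly_Mapping.lookup m 1"]
      arg_cong [OF e, of "\<lambda>m. Poly_Mapping.lookup m 2"]
      arg_cong [OF e, of "\<lambda>m. Poly_Mapping.lookup m 3"]
      arg_cong [OF e, of "\<lambda>m. Poly_Mapping.lookup m 4"]
    by (simp add: lookup_add)
next
  assume "a \<le> a' \<and> b \<le> b' \<and> c \<le> c' \<and> d \<le> d'"
  then have "expo a' b' c' d' = expo a b c d + expo (a' - a) (b' - b) (c' - c) (d' - d)"
    by (simp add: expo_add)
  then show "mono_dvd (expo a b c d) (expo a' b' c' d')"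
    unfolding mono_dvd_def by blast
qed

lemma total_degree_expo [simp]: "total_degree (expo a b c d) = a + b + c + d"
  by (simp add: total_degree_def sum_4)

lemma total_degree_add: "total_degree (u + v) = total_degree u + total_degree v"
  by (simp add: total_degree_def lookup_add sum.distrib)

definition weight :: "(4 \<Rightarrow> nat) \<Rightarrow> (4 \<Rightarrow>\<^sub>0 nat) \<Rightarrow> nat" where
  "weight n m = (\<Sum>i\<in>UNIV. Poly_Mapping.lookup m i * n i)"

lemma weight_expo [simp]: "weight n (expo a b c d) = a * n 1 + b * n 2 + c * n 3 + d * n 4"
  by (simp add: weight_def sum_4)

lemma weight_add: "weight n (u + v) = weight n u + weight n v"
  by (simp add: weight_def lookup_add sum.distrib algebra_simps)

lemma lookup_le_weight:
  assumes "\<And>i. 0 < n i"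
  shows "Poly_Mapping.lookup m i \<le> weight n m"
proof -
  have "Poly_Mapping.lookup m i \<le> Poly_Mapping.lookup m i * n i"
    using assms [of i] by simp
  also have "\<dots> \<le> weight n m"
    unfolding weight_def by (rule member_le_sum) auto
  finally show ?thesis .
qed

lemma total_degree_le_weight:
  assumes "\<And>i. 0 < n i"
  shows "total_degree m \<le> weight n m"
  unfolding total_degree_def weight_def by (rule sum_mono) (use assms in \<open>simp add: Suc_le_eq\<close>)


section \<open>The ideal of a monomial curve\<close>

text \<open>The monomial \<open>xm m\<close> is sent to t to the power \<open>weight n m\<close>, so
  lying in the kernel becomes one linear condition on the coefficients per weight.\<close>

lemma coeff_curve_hom:
  "coeff (curve_hom n f) w
     = (\<Sum>m\<in>{m \<in> Poly_Mapping.keys f. weight n m = w}. Poly_Mapping.lookup f m)"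
proof -
  have "(\<Prod>i\<in>UNIV. monom (1::'a) (n i) ^ Poly_Mapping.lookup m i) = monom 1 (weight n m)" for m
  proof -
    have "(\<Prod>i\<in>A. monom (1::'a) (n i) ^ Poly_Mapping.lookup m i)
        = monom 1 (\<Sum>i\<in>A. Poly_Mapping.lookup m i * n i)" if "finite A" for A
      using that by (induction A rule: finite_induct)
        (simp_all add: monom_power mult_monom mult.commute)
    then show ?thesis by (simp add: weight_def)
  qed
  then have "coeff (curve_hom n f) w
      = (\<Sum>m\<in>Poly_Mapping.keys f. if weight n m = w then Poly_Mapping.lookup f m else 0)"
    by (simp add: curve_hom_def coeff_sum if_distrib cong: if_cong)
  then show ?thesis
    by (simp add: sum.inter_filter)
qed

lemma curve_ideal_iff:
  "f \<in> curve_ideal n \<longleftrightarrow>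
     (\<forall>w. (\<Sum>m\<in>{m \<in> Poly_Mapping.keys f. weight n m = w}. Poly_Mapping.lookup f m) = 0)"
  by (simp add: curve_ideal_def a_kernel_def kernel_def ring_of_type_algebra_def poly_eq_iff
      coeff_curve_hom)

lemma keys_binomial: "u \<noteq> v \<Longrightarrow> Poly_Mapping.keys (xm u - xm v) = {u, v}"
  by (auto simp: in_keys_iff lookup_minus lookup_single when_def split: if_splits)

lemma binomial_in_curve_ideal: "xm u - xm v \<in> curve_ideal n \<longleftrightarrow> weight n u = weight n v"
proof (cases "u = v")
  case False
  have *: "{m \<in> {u, v}. weight n m = w}
      = (if weight n u = w then {u} else {}) \<union> (if weight n v = w then {v} else {})" for w
    by auto
  show ?thesis
    unfolding curve_ideal_iff keys_binomial [OF False] *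
    using False by (auto simp: lookup_minus lookup_single_not_eq)
qed (simp add: curve_ideal_iff)

lemma mono_mult_binomial: "xm e * (xm u - xm v) = xm (u + e) - xm (v + e)"
  by (simp add: algebra_simps mult_single)


section \<open>Initial forms\<close>

lemma lookup_homogeneous_summand:
  "Poly_Mapping.lookup (homogeneous_summand d f) m
     = (if total_degree m = d then Poly_Mapping.lookup f m else 0)"
proof -
  have "Poly_Mapping.lookup (homogeneous_summand d f) m
      = (\<Sum>m'\<in>{m' \<in> Poly_Mapping.keys f. total_degree m' = d}.
          if m' = m then Poly_Mapping.lookup f m else 0)"
    unfolding homogeneous_summand_def lookup_sum
    by (intro sum.cong) (auto simp: lookup_single when_def)
  then show ?thesis
    by (simp add: in_keys_iff)
qed

lemma homogeneous_summand_eq_0_iff: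
  "homogeneous_summand d f = 0 \<longleftrightarrow> (\<forall>m\<in>Poly_Mapping.keys f. total_degree m \<noteq> d)"
  by (auto simp: poly_mapping_eq_iff fun_eq_iff lookup_homogeneous_summand in_keys_iff)

text \<open>For \<open>u\<close> different from \<open>v\<close> this says that \<open>u\<close> has
  at most the degree of \<open>v\<close> and \<open>J\<close> contains the initial form of
  \<open>xm u - xm v\<close>. For an ideal \<open>J\<close> the relation is transitive, so it can be
  chained along rewriting steps.\<close>

definition leads_to :: "'k::field poly4 set \<Rightarrow> (4 \<Rightarrow>\<^sub>0 nat) \<Rightarrow> (4 \<Rightarrow>\<^sub>0 nat) \<Rightarrow> bool" where
  "leads_to J u v \<longleftrightarrow> total_degree u < total_degree v \<and> xm u \<in> J
     \<or> total_degree u = total_degree v \<and> xm u - xm v \<in> J"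

text \<open>For a weight-homogeneous \<open>f \<in> I(C)\<close> the coefficients sum to zero, so the initial form is
  a sum of homogeneous binomials if \<open>f\<close> is homogeneous, while otherwise its monomials are the
  low-degree monomials of some inhomogeneous binomials in \<open>I(C)\<close>.\<close>

lemma initial_form_curve_in_ideal:
  assumes J: "ideal J poly4_ring"
    and lead: "\<And>u v. weight n u = weight n v \<Longrightarrow> total_degree u \<le> total_degree v \<Longrightarrow> leads_to J u v"
    and f: "f \<in> curve_ideal n" "f \<noteq> 0"
  shows "initial_form f \<in> J"
proof -
  define d where "d = (LEAST d. homogeneous_summand d f \<noteq> 0)"
  define S where "S = {m \<in> Poly_Mapping.keys f. total_degree m = d}"
  define T where "T w = {m \<in> S. weight n m = w}" for w
  have fin: "finite S" unfolding S_def by simp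
  have deg_ge: "d \<le> total_degree m" if "m \<in> Poly_Mapping.keys f" for m
    unfolding d_def by (rule Least_le) (use that in \<open>auto simp: homogeneous_summand_eq_0_iff\<close>)
  have part: "(\<Sum>m\<in>T w. Poly_Mapping.single m (Poly_Mapping.lookup f m)) \<in> J" for w
  proof (cases "\<exists>v\<in>Poly_Mapping.keys f. weight n v = w \<and> total_degree v > d")
    case True
    then obtain v where v: "weight n v = w" "total_degree v > d" by blast
    show ?thesis
    proof (rule ideal_poly4_sum [OF J])
      fix m assume "m \<in> T w"
      then have "leads_to J m v" and "total_degree m = d"
        using v by (auto intro!: lead simp: T_def S_def)
      then have "xm m \<in> J"
        using v by (simp add: leads_to_def)
      from ideal_poly4_mult [OF J this, of "Poly_Mapping.single 0 (Poly_Mapping.lookup f m)"]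
      show "Poly_Mapping.single m (Poly_Mapping.lookup f m) \<in> J"
        by (simp add: mult_single)
    qed
  next
    case False
    \<comment> \<open>Monomials of weight \<open>w\<close> in \<open>f\<close> have degree neither
      above nor below \<open>d\<close>, so \<open>T w\<close> is a whole weight component and its
      coefficients sum to zero.\<close>
    then have T: "T w = {m \<in> Poly_Mapping.keys f. weight n m = w}"
      using deg_ge unfolding T_def S_def by force
    show ?thesis
    proof (cases "T w = {}")
      case True
      then show ?thesis using ideal_poly4_zero [OF J] by simp
    next
      case False
      then obtain v where v: "v \<in> T w" by blast
      have "(\<Sum>m\<in>T w. Poly_Mapping.single v (Poly_Mapping.lookup f m))
          = Poly_Mapping.single v (\<Sum>m\<in>T w. Poly_Mapping.lookup f m)"
        by (rule poly_mapping_eqI) (auto simp: lookup_sum lookup_single when_def)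
      also have "\<dots> = 0"
        using f(1) by (simp add: T curve_ideal_iff)
      finally have "(\<Sum>m\<in>T w. Poly_Mapping.single m (Poly_Mapping.lookup f m))
          = (\<Sum>m\<in>T w. Poly_Mapping.single 0 (Poly_Mapping.lookup f m) * (xm m - xm v))"
        by (simp add: algebra_simps mult_single sum_subtractf)
      also have "\<dots> \<in> J"
      proof (intro ideal_poly4_sum [OF J] ideal_poly4_mult [OF J])
        fix m assume "m \<in> T w"
        with v have "leads_to J m v" "total_degree m = total_degree v"
          by (auto intro!: lead simp: T_def S_def)
        then show "xm m - xm v \<in> J"
          by (simp add: leads_to_def)
      qed
      finally show ?thesis .
    qed
  qed
  have "initial_form f = (\<Sum>m\<in>S. Poly_Mapping.single m (Poly_Mapping.lookup f m))"
    by (simp add: initial_form_def homogeneous_summand_def d_def S_def)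
  also have "\<dots> = (\<Sum>w\<in>weight n ` S. \<Sum>m\<in>T w. Poly_Mapping.single m (Poly_Mapping.lookup f m))"
    unfolding T_def by (rule sum.image_gen [OF fin])
  also have "\<dots> \<in> J"
    by (intro ideal_poly4_sum [OF J] part)
  finally show ?thesis .
qed

text \<open>A pair stands both for a rewriting rule and for a binomial. When the rule does not lower
  the degree, this is the initial form of the binomial; the two branches are the case distinctions
  in \<open>p2\<close> and \<open>p6\<close>.\<close>

definition lead_form :: "(4 \<Rightarrow>\<^sub>0 nat) \<times> (4 \<Rightarrow>\<^sub>0 nat) \<Rightarrow> 'k::field poly4" where
  "lead_form = (\<lambda>(u, v). if total_degree u < total_degree v then xm u else xm u - xm v)"

lemma initial_form_binomial:
  assumes "u \<noteq> v" "total_degree u \<le> total_degree v"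
  shows "initial_form (xm u - xm v) = lead_form (u, v)"
proof -
  have "(LEAST d. homogeneous_summand d (xm u - xm v :: 'a poly4) \<noteq> 0) = total_degree u"
    by (rule Least_equality)
      (use assms in \<open>auto simp: homogeneous_summand_eq_0_iff keys_binomial\<close>)
  then show ?thesis
    unfolding initial_form_def using assms
    by (auto intro!: poly_mapping_eqI simp: lookup_homogeneous_summand lookup_minus
        lookup_single when_def lead_form_def)
qed

lemma keys_lead_form:
  assumes "u \<noteq> v"
  shows "u \<in> Poly_Mapping.keys (lead_form (u, v) :: 'k::field poly4)"
    and "d \<in> Poly_Mapping.keys (lead_form (u, v) :: 'k poly4) \<Longrightarrow>
      d = u \<or> d = v \<and> \<not> total_degree u < total_degree v"
  using assms by (auto simp: lead_form_def keys_binomial split: if_splits)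


section \<open>Rewriting monomials to standard monomials\<close>

lemma leads_to_refl: "ideal J poly4_ring \<Longrightarrow> leads_to J u u"
  by (simp add: leads_to_def ideal_poly4_zero)

lemma leads_to_trans:
  assumes J: "ideal J poly4_ring" and "leads_to J u v" "leads_to J v w"
  shows "leads_to J u w"
proof -
  have "xm u \<in> J" if "xm u - xm v \<in> J" "xm v \<in> J"
    using ideal_poly4_add [OF J that] by simp
  moreover have "xm u - xm w \<in> J" if "xm u - xm v \<in> J" "xm v - xm w \<in> J"
    using ideal_poly4_add [OF J that] by simp
  ultimately show ?thesis
    using assms(2,3) unfolding leads_to_def by auto
qed

lemma leads_to_add:
  assumes J: "ideal J poly4_ring" and "leads_to J u v"
  shows "leads_to J (u + e) (v + e)"
  using assms(2) ideal_poly4_mult [OF J, of "xm u" "xm e"]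
    ideal_poly4_mult [OF J, of "xm u - xm v" "xm e"]
  unfolding leads_to_def mono_mult_binomial total_degree_add
  by (auto simp: mult_single add.commute)

lemma leads_to_lead_form:
  assumes "lead_form (u, v) \<in> J" "total_degree u \<le> total_degree v"
  shows "leads_to J u v"
  using assms by (auto simp: leads_to_def lead_form_def split: if_splits)

text \<open>Each rewriting step raises \<open>deg + deg\<^bsub>x\<^sub>1\<^esub>\<close>, which is bounded in terms of the weight.\<close>

lemma rewrite_to_standard:
  assumes J: "ideal J poly4_ring" and n: "\<And>i. 0 < n i"
    and S: "\<And>u v. (u, v) \<in> S \<Longrightarrow> weight n u = weight n v"
      "\<And>u v. (u, v) \<in> S \<Longrightarrow> leads_to J u v"
      "\<And>u v. (u, v) \<in> S \<Longrightarrow>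
         total_degree u + Poly_Mapping.lookup u 1 < total_degree v + Poly_Mapping.lookup v 1"
  shows "\<exists>v. weight n u = weight n v \<and> leads_to J u v \<and> (\<forall>(l, r) \<in> S. \<not> mono_dvd l v)"
proof (induction "2 * weight n u - (total_degree u + Poly_Mapping.lookup u 1)"
    arbitrary: u rule: less_induct)
  case less
  show ?case
  proof (cases "\<forall>(l, r) \<in> S. \<not> mono_dvd l u")
    case True
    then show ?thesis using leads_to_refl [OF J] by blast
  next
    case False
    then obtain l r e where lr: "(l, r) \<in> S" and u: "u = l + e"
      by (auto simp: mono_dvd_def)
    define v where "v = r + e"
    have w: "weight n u = weight n v"
      using S(1) [OF lr] by (simp add: u v_def weight_add)
    have l: "leads_to J u v"
      using leads_to_add [OF J S(2) [OF lr]] by (simp add: u v_def)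
    have "total_degree u + Poly_Mapping.lookup u 1 < total_degree v + Poly_Mapping.lookup v 1"
      using S(3) [OF lr] by (simp add: u v_def total_degree_add lookup_add)
    \<comment> \<open>Each summand is at most the weight, whence the factor 2; truncated subtraction
      therefore cannot hide the decrease of the measure.\<close>
    moreover have "total_degree v + Poly_Mapping.lookup v 1 \<le> 2 * weight n v"
      using total_degree_le_weight [of n v] lookup_le_weight [of n v 1] n by simp
    ultimately have "2 * weight n v - (total_degree v + Poly_Mapping.lookup v 1)
        < 2 * weight n u - (total_degree u + Poly_Mapping.lookup u 1)"
      using w by simp
    from less [OF this] obtain v' where
      "weight n v = weight n v'" "leads_to J v v'" "\<forall>(l, r) \<in> S. \<not> mono_dvd l v'"
      by blast
    then show ?thesis
      using w leads_to_trans [OF J l] by metis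
  qed
qed

text \<open>Two monomials of equal weight rewrite to irreducible ones of that weight, which
  \<open>unique\<close> makes equal. Meeting there, they are related by \<open>leads_to\<close>, as
  \<open>initial_form_curve_in_ideal\<close> requires; \<open>unique\<close> thus takes the place of
  reducing S-polynomials.\<close>

lemma initial_ideal_curve_eq:
  fixes S :: "((4 \<Rightarrow>\<^sub>0 nat) \<times> (4 \<Rightarrow>\<^sub>0 nat)) set"
  assumes n: "\<And>i. 0 < n i"
    and S: "\<And>u v. (u, v) \<in> S \<Longrightarrow> weight n u = weight n v"
      "\<And>u v. (u, v) \<in> S \<Longrightarrow> total_degree u \<le> total_degree v"
      "\<And>u v. (u, v) \<in> S \<Longrightarrow>
         total_degree u + Poly_Mapping.lookup u 1 < total_degree v + Poly_Mapping.lookup v 1"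
    and unique: "\<And>u v. weight n u = weight n v \<Longrightarrow> \<forall>(l, r) \<in> S. \<not> mono_dvd l u \<Longrightarrow>
        \<forall>(l, r) \<in> S. \<not> mono_dvd l v \<Longrightarrow> u = v"
  shows "ideal_gen (lead_form ` S) = initial_ideal (curve_ideal n :: 'k::field poly4 set)"
proof
  let ?J = "ideal_gen (lead_form ` S) :: 'k poly4 set"
  have J: "ideal ?J poly4_ring" by (rule ideal_ideal_gen)
  show "?J \<subseteq> initial_ideal (curve_ideal n)"
  proof (rule ideal_gen_minimal)
    show "ideal (initial_ideal (curve_ideal n :: 'k poly4 set)) poly4_ring"
      unfolding initial_ideal_def by (rule ideal_ideal_gen)
    show "lead_form ` S \<subseteq> initial_ideal (curve_ideal n :: 'k poly4 set)"
    proof (safe)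
      fix u v assume uv: "(u, v) \<in> S"
      then have ne: "u \<noteq> v" using S(3) by blast
      have "xm u - xm v \<in> (curve_ideal n :: 'k poly4 set)"
        using S(1) [OF uv] by (simp add: binomial_in_curve_ideal)
      moreover have "xm u - xm v \<noteq> (0 :: 'k poly4)"
        using keys_binomial [OF ne, where 'a = 'k] by auto
      ultimately show "lead_form (u, v) \<in> initial_ideal (curve_ideal n :: 'k poly4 set)"
        unfolding initial_ideal_def initial_form_binomial [OF ne S(2) [OF uv], symmetric]
        by (intro subsetD [OF ideal_gen_superset]) blast
    qed
  qed
  have S_J: "leads_to ?J u v" if "(u, v) \<in> S" for u v
    using that by (intro leads_to_lead_form S(2) subsetD [OF ideal_gen_superset]) auto
  have lead: "leads_to ?J u v" if w: "weight n u = weight n v" and d: "total_degree u \<le> total_degree v"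
    for u v
  proof -
    have ex: "\<exists>v. weight n u = weight n v \<and> leads_to ?J u v \<and> (\<forall>(l, r) \<in> S. \<not> mono_dvd l v)" for u
      by (rule rewrite_to_standard [OF J n]) (erule S(1) S_J S(3))+
    obtain u' where u': "weight n u = weight n u'" "leads_to ?J u u'"
      "\<forall>(l, r) \<in> S. \<not> mono_dvd l u'"
      using ex [of u] by blast
    obtain v' where v': "weight n v = weight n v'" "leads_to ?J v v'"
      "\<forall>(l, r) \<in> S. \<not> mono_dvd l v'"
      using ex [of v] by blast
    have "u' = v'" using unique u' v' w by simp
    \<comment> \<open>If \<open>u\<close> has smaller degree than \<open>v\<close>, it also has
      smaller degree than \<open>v'\<close>, so \<open>xm u\<close> is in the ideal. For equal
      degrees, either both monomials lie in the ideal or their binomials with \<open>v'\<close> are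
      subtracted.\<close>
    show ?thesis
      using u'(2) v'(2) d ideal_poly4_diff [OF J, of "xm u - xm v'" "xm v - xm v'"]
        ideal_poly4_diff [OF J, of "xm u" "xm v"]
      unfolding \<open>u' = v'\<close> leads_to_def by auto
  qed
  show "initial_ideal (curve_ideal n) \<subseteq> ?J"
    unfolding initial_ideal_def
    by (intro ideal_gen_minimal J) (auto intro: initial_form_curve_in_ideal [OF J lead])
qed

text \<open>The monomial \<open>u\<close> of a generator is divisible by no monomial of another one,
  since \<open>v'\<close> occurs in \<open>lead_form (u', v')\<close> only if the degree does not
  rise. By \<open>keys_ideal_gen\<close>, no generator lies in the ideal of the others.\<close>

lemma
  fixes S :: "((4 \<Rightarrow>\<^sub>0 nat) \<times> (4 \<Rightarrow>\<^sub>0 nat)) set"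
  assumes ne: "\<And>u v. (u, v) \<in> S \<Longrightarrow> u \<noteq> v"
    and indep: "\<And>u v u' v'. (u, v) \<in> S \<Longrightarrow> (u', v') \<in> S \<Longrightarrow> (u, v) \<noteq> (u', v') \<Longrightarrow>
        \<not> mono_dvd u' u \<and> (mono_dvd v' u \<longrightarrow> total_degree u' < total_degree v')"
  shows inj_on_lead_form: "inj_on (lead_form :: _ \<Rightarrow> 'k::field poly4) S"
    and minimally_generates_lead_form:
      "minimally_generates (lead_form ` S) (ideal_gen (lead_form ` S) :: 'k poly4 set)"
proof -
  let ?g = "lead_form :: _ \<Rightarrow> 'k poly4"
  have not_key: "d \<notin> Poly_Mapping.keys (?g (u', v'))"
    if "(d + e, v) \<in> S" "(u', v') \<in> S" "(d + e, v) \<noteq> (u', v')" for d e v u' v'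
    using indep [OF that] keys_lead_form(2) [OF ne [OF that(2)], where 'k = 'k]
    by (auto simp: mono_dvd_def)
  show "inj_on ?g S"
  proof (rule inj_onI, rule ccontr)
    fix p q assume "p \<in> S" "q \<in> S" "?g p = ?g q" "p \<noteq> q"
    then show False
      using not_key [of "fst p" 0 "snd p" "fst q" "snd q"]
        keys_lead_form(1) [of "fst p" "snd p", where 'k = 'k] ne [of "fst p" "snd p"]
      by simp
  qed
  show "minimally_generates (?g ` S) (ideal_gen (?g ` S))"
    unfolding minimally_generates_def
  proof (intro conjI refl allI impI notI)
    fix H assume H: "H \<subset> ?g ` S" "ideal_gen H = ideal_gen (?g ` S)"
    then obtain u v where uv: "(u, v) \<in> S" "?g (u, v) \<notin> H" by auto
    have "?g (u, v) \<in> ideal_gen H"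
      unfolding H(2) using uv(1) ideal_gen_superset by blast
    then obtain g d e where gde: "g \<in> H" "d \<in> Poly_Mapping.keys g" "u = d + e"
      using keys_lead_form(1) [OF ne [OF uv(1)]] by (rule keys_ideal_gen)
    have "g \<in> ?g ` S" using H(1) gde(1) by blast
    then obtain u' v' where uv': "(u', v') \<in> S" "g = ?g (u', v')" by fastforce
    then show False
      using not_key [of d e v u' v'] gde uv by auto
  qed
qed


section \<open>Exponents of Gorenstein curves\<close>

text \<open>The disjuncts in \<open>fiber\<close> are the ten monomials occurring in \<open>f\<^sub>1, \<dots>, f\<^sub>5\<close>.\<close>

locale gorenstein_exponents =
  fixes n :: "4 \<Rightarrow> nat" and a1 a2 a3 a4 a12 a13 a21 a24 a32 a34 a41 a43 :: nat
  assumes n_pos: "\<And>i. 0 < n i"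
    and f1_weight: "a1 * n 1 = a12 * n 2 + a13 * n 3"
    and f2_weight: "a2 * n 2 = a21 * n 1 + a24 * n 4"
    and f3_weight: "a3 * n 3 = a32 * n 2 + a34 * n 4"
    and f4_weight: "a4 * n 4 = a41 * n 1 + a43 * n 3"
    and f5_weight: "a41 * n 1 + a32 * n 2 = a13 * n 3 + a24 * n 4"
    and bounds: "0 < a21" "a21 < a1" "0 < a41" "a41 < a1" "0 < a12" "a12 < a2" "0 < a32" "a32 < a2"
      "0 < a13" "a13 < a3" "0 < a43" "a43 < a3" "0 < a24" "a24 < a4" "0 < a34" "a34 < a4"
    and fiber: "a * n 1 + b * n 2 + c * n 3 + d * n 4
        = a' * n 1 + b' * n 2 + c' * n 3 + d' * n 4 \<Longrightarrow>
      (a, b, c, d) \<noteq> (a', b', c', d') \<Longrightarrow>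
      a1 \<le> a \<or> a12 \<le> b \<and> a13 \<le> c \<or> a2 \<le> b \<or> a21 \<le> a \<and> a24 \<le> d \<or> a3 \<le> c \<or> a32 \<le> b \<and> a34 \<le> d \<or>
      a4 \<le> d \<or> a41 \<le> a \<and> a43 \<le> c \<or> a41 \<le> a \<and> a32 \<le> b \<or> a13 \<le> c \<and> a24 \<le> d"
begin

text \<open>The relations of \<open>f1\<close> and \<open>f5\<close> give x_2^(a12+a32) the weight
  of x_1^(a1-a41) x_4^a24, so \<open>fiber\<close> yields \<open>a2 \<le> a12 + a32\<close>.
  Comparison with \<open>f2\<close> leaves a power of x_2 of exponent below \<open>a2\<close> with
  the weight of a power of x_1; by \<open>fiber\<close> it must be 1.\<close>

lemma bresinsky_a1_a2: "a2 = a12 + a32"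
proof -
  have eq: "(a12 + a32) * n 2 + a41 * n 1 = a1 * n 1 + a24 * n 4"
    using f1_weight f5_weight by (simp add: algebra_simps)
  have "0 * n 1 + (a12 + a32) * n 2 + 0 * n 3 + 0 * n 4
      = (a1 - a41) * n 1 + 0 * n 2 + 0 * n 3 + a24 * n 4"
    using eq bounds(4) by (simp add: diff_mult_distrib)
  from fiber [OF this] have le: "a2 \<le> a12 + a32" using bounds by auto
  have "(a12 + a32 - a2) * n 2 = a1 * n 1 - a41 * n 1 - a21 * n 1"
    using eq f2_weight by (simp add: diff_mult_distrib)
  then have "0 * n 1 + (a12 + a32 - a2) * n 2 + 0 * n 3 + 0 * n 4
      = (a1 - a41 - a21) * n 1 + 0 * n 2 + 0 * n 3 + 0 * n 4"
    by (simp add: diff_mult_distrib add_mult_distrib)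
  from fiber [OF this] show ?thesis using bounds le by (cases "a2 = a12 + a32") auto
qed

text \<open>The argument for \<open>a2\<close>, applied to \<open>f3\<close>, \<open>f5\<close> and
  \<open>f4\<close>, gives the first equation; inserting it into the combined weight relation and
  cancelling \<open>n 3\<close> gives the second.\<close>

lemma bresinsky_a3_a4: "a4 = a24 + a34" "a3 = a13 + a43"
proof -
  have eq: "(a24 + a34) * n 4 + a13 * n 3 = a41 * n 1 + a3 * n 3"
    using f3_weight f5_weight by (simp add: algebra_simps)
  have "0 * n 1 + 0 * n 2 + 0 * n 3 + (a24 + a34) * n 4
      = a41 * n 1 + 0 * n 2 + (a3 - a13) * n 3 + 0 * n 4"
    using eq bounds by (simp add: diff_mult_distrib)
  from fiber [OF this] have le: "a4 \<le> a24 + a34" using bounds by auto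
  have "(a24 + a34 - a4) * n 4 = a3 * n 3 - a13 * n 3 - a43 * n 3"
    using eq f4_weight by (simp add: diff_mult_distrib)
  then have "0 * n 1 + 0 * n 2 + 0 * n 3 + (a24 + a34 - a4) * n 4
      = 0 * n 1 + 0 * n 2 + (a3 - a13 - a43) * n 3 + 0 * n 4"
    by (simp add: diff_mult_distrib add_mult_distrib)
  from fiber [OF this] show a4: "a4 = a24 + a34"
    using bounds le by (cases "a4 = a24 + a34") auto
  have "a3 * n 3 = (a13 + a43) * n 3"
    using eq f4_weight unfolding a4 [symmetric] by (simp add: algebra_simps)
  then show "a3 = a13 + a43" using n_pos [of 3] by simp
qed

text \<open>The conjuncts say that none of the six rewriting rules applies. The exponent of x_1 is
  absent because x_1 divides no left-hand side.\<close>

definition standard :: "nat \<Rightarrow> nat \<Rightarrow> nat \<Rightarrow> bool" where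
  "standard b c d \<longleftrightarrow> \<not> (a12 \<le> b \<and> a13 \<le> c) \<and> b < a2 \<and> \<not> (a32 \<le> b \<and> a34 \<le> d) \<and> d < a4
     \<and> \<not> (a13 \<le> c \<and> a24 \<le> d) \<and> c < a3 + a13"

text \<open>By \<open>fiber\<close>, the right-hand monomial is divisible by \<open>x\<^sub>3\<^bsup>a\<^sub>3\<^esup>\<close> and the left-hand one is not.
  Replacing \<open>x\<^sub>3\<^bsup>a\<^sub>3\<^esup>\<close> by \<open>x\<^sub>2\<^bsup>a\<^sub>3\<^sub>2\<^esup> x\<^sub>4\<^bsup>a\<^sub>3\<^sub>4\<^esup>\<close> on the right forces the left one to be a power
  of \<open>x\<^sub>1\<close>, and replacing \<open>x\<^sub>1\<^bsup>a\<^sub>1\<^esup>\<close> by \<open>x\<^sub>2\<^bsup>a\<^sub>1\<^sub>2\<^esup> x\<^sub>3\<^bsup>a\<^sub>1\<^sub>3\<^esup>\<close> there contradicts \<open>fiber\<close>.\<close>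

lemma standard_disjoint_eq:
  assumes a12_le: "a12 \<le> a32"
    and std: "standard b c d" "standard b' c' d'"
    and w: "a * n 1 + b * n 2 + c * n 3 + d * n 4 = b' * n 2 + c' * n 3 + d' * n 4"
    and disj: "b = 0 \<or> b' = 0" "c = 0 \<or> c' = 0" "d = 0 \<or> d' = 0"
  shows "(a, b, c, d) = (0, b', c', d')"
proof (rule ccontr)
  assume ne: "(a, b, c, d) \<noteq> (0, b', c', d')"
  note a2 = bresinsky_a1_a2 and a4 = bresinsky_a3_a4(1) and a3 = bresinsky_a3_a4(2)
  have "a3 \<le> c'"
    using fiber [of 0 b' c' d' a b c d] w ne std(2) bounds unfolding standard_def by auto
  then obtain e where e: "c' = a3 + e" using le_Suc_ex by blast
  have small: "e < a13" "b' < a12" "d' < a24" "c = 0"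
    using std(2) disj e bounds unfolding standard_def by auto
  have a_pos: "0 < a"
    using fiber [of a b c d 0 b' c' d'] w ne std(1) small bounds unfolding standard_def by auto
  \<comment> \<open>After x_3^a3 is replaced on the right, x_2^i x_4^j is the common factor to be
    cancelled.\<close>
  define i j where "i = min b (a32 + b')" and "j = min d (a34 + d')"
  have w': "a * n 1 + b * n 2 + d * n 4 = (a32 + b') * n 2 + e * n 3 + (a34 + d') * n 4"
    using w f3_weight small(4) by (simp add: e algebra_simps)
  obtain b1 b2 d1 d2 where split: "b = i + b1" "a32 + b' = i + b2" "d = j + d1" "a34 + d' = j + d2"
    unfolding i_def j_def by (metis le_Suc_ex min.cobounded1 min.cobounded2)
  have "0 * n 1 + b2 * n 2 + e * n 3 + d2 * n 4 = a * n 1 + b1 * n 2 + 0 * n 3 + d1 * n 4"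
    using w' unfolding split by (simp add: algebra_simps)
  from fiber [OF this] have "a32 \<le> b2 \<and> a34 \<le> d2"
    using a_pos small split a2 a4 a12_le bounds by auto
  \<comment> \<open>At most \<open>b'\<close> factors x_2 and \<open>d'\<close> factors x_4 were
    cancelled, so \<open>b \<le> b'\<close> and \<open>d \<le> d'\<close>; disjointness makes
    \<open>b\<close> and \<open>d\<close> vanish.\<close>
  then have bd: "b = 0" "d = 0"
    using disj split bounds unfolding i_def j_def by (auto simp: min_def split: if_splits)
  have "a1 \<le> a"
    using fiber [of a b c d 0 b' c' d'] w ne bd small bounds by auto
  then obtain k where k: "a = a1 + k" using le_Suc_ex by blast
  obtain h where h: "a12 = b' + h" "0 < h"
    using small(2) less_imp_add_positive by blast
  \<comment> \<open>Cancelling x_2^b' x_3^a13 leaves on one side only x_3 with exponent below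
    \<open>a3\<close> and x_4 with exponent below \<open>a24\<close>, which no monomial listed in
    \<open>fiber\<close> divides.\<close>
  have "0 * n 1 + 0 * n 2 + (a43 + e) * n 3 + d' * n 4 = k * n 1 + h * n 2 + 0 * n 3 + 0 * n 4"
    using w f1_weight bd small(4) unfolding k e h a3 by (simp add: algebra_simps)
  from fiber [OF this] show False
    using h small a3 a4 bounds by auto
qed

lemma standard_mono: "standard b c d \<Longrightarrow> b' \<le> b \<Longrightarrow> c' \<le> c \<Longrightarrow> d' \<le> d \<Longrightarrow> standard b' c' d'"
  unfolding standard_def by auto

text \<open>Cancelling the greatest common divisor leaves coprime monomials, still standard, with
  x_1 on one side only; the order of \<open>a\<close> and \<open>a'\<close> is settled by
  symmetry.\<close>

lemma standard_unique:
  assumes a12_le: "a12 \<le> a32"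
    and std: "standard b c d" "standard b' c' d'"
    and w: "a * n 1 + b * n 2 + c * n 3 + d * n 4 = a' * n 1 + b' * n 2 + c' * n 3 + d' * n 4"
  shows "a = a' \<and> b = b' \<and> c = c' \<and> d = d'"
proof -
  have *: "a = a' \<and> b = b' \<and> c = c' \<and> d = d'"
    if le: "a' \<le> a" and std: "standard b c d" "standard b' c' d'"
      and w: "a * n 1 + b * n 2 + c * n 3 + d * n 4 = a' * n 1 + b' * n 2 + c' * n 3 + d' * n 4"
    for a b c d a' b' c' d'
  proof -
    define i j k where "i = min b b'" and "j = min c c'" and "k = min d d'"
    have "(a - a') * n 1 + (b - i) * n 2 + (c - j) * n 3 + (d - k) * n 4
        = (b' - i) * n 2 + (c' - j) * n 3 + (d' - k) * n 4"
    proof -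
      obtain a0 b0 b0' c0 c0' d0 d0' where split: "a = a' + a0" "b = i + b0" "b' = i + b0'"
        "c = j + c0" "c' = j + c0'" "d = k + d0" "d' = k + d0'"
        unfolding i_def j_def k_def by (metis le le_Suc_ex min.cobounded1 min.cobounded2)
      then show ?thesis using w unfolding split by (simp add: algebra_simps)
    qed
    moreover have "standard (b - i) (c - j) (d - k)" "standard (b' - i) (c' - j) (d' - k)"
      using std by (auto elim: standard_mono)
    moreover have "b - i = 0 \<or> b' - i = 0" "c - j = 0 \<or> c' - j = 0" "d - k = 0 \<or> d' - k = 0"
      unfolding i_def j_def k_def by auto
    ultimately have "(a - a', b - i, c - j, d - k) = (0, b' - i, c' - j, d' - k)"
      by (intro standard_disjoint_eq [OF a12_le])
    moreover have "i \<le> b" "i \<le> b'" "j \<le> c" "j \<le> c'" "k \<le> d" "k \<le> d'"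
      unfolding i_def j_def k_def by auto
    ultimately show ?thesis using le by auto
  qed
  show ?thesis
    using * [of a' a b c d b' c' d'] * [of a a' b' c' d' b c d] std w by (cases "a' \<le> a") auto
qed

end


section \<open>The tangent cone\<close>

theorem theorem2p18:
  fixes n :: "4 \<Rightarrow> nat"
    and I :: "'k::field poly4 set"
    and f1 f2 f3 f4 f5 p2 p6 :: "'k poly4"
    and a1 a2 a3 a4 a12 a13 a21 a24 a32 a34 a41 a43 :: nat
  defines "I \<equiv> curve_ideal n"
    and "f1 \<equiv> Var 1 ^ a1 - Var 2 ^ a12 * Var 3 ^ a13"
    and "f2 \<equiv> Var 2 ^ a2 - Var 1 ^ a21 * Var 4 ^ a24"
    and "f3 \<equiv> Var 3 ^ a3 - Var 2 ^ a32 * Var 4 ^ a34"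
    and "f4 \<equiv> Var 4 ^ a4 - Var 1 ^ a41 * Var 3 ^ a43"
    and "f5 \<equiv> Var 1 ^ a41 * Var 2 ^ a32 - Var 3 ^ a13 * Var 4 ^ a24"
    and "p2 \<equiv> (if a2 < a21 + a24 then Var 2 ^ a2
               else Var 2 ^ a2 - Var 1 ^ a21 * Var 4 ^ a24)"
    and "p6 \<equiv> (if a3 + a13 < a1 + a32 - a12 + a34 then Var 3 ^ (a3 + a13)
               else Var 3 ^ (a3 + a13) - Var 1 ^ a1 * Var 2 ^ (a32 - a12) * Var 4 ^ a34)"
  assumes "0 < n 1" "n 1 < n 2" "n 2 < n 3" "n 3 < n 4"
    and "Gcd {n 1, n 2, n 3, n 4} = 1"
    and "gorenstein_curve n"
    and "\<not> complete_intersection I"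
    and "cm_tangent_cone I"
    and "minimally_generates {f1, f2, f3, f4, f5} I"
    and "a1 > 1" "a2 > 1" "a3 > 1" "a4 > 1"
    and "0 < a21" "a21 < a1" "0 < a41" "a41 < a1"
    and "0 < a12" "a12 < a2" "0 < a32" "a32 < a2"
    and "0 < a13" "a13 < a3" "0 < a43" "a43 < a3"
    and "0 < a24" "a24 < a4" "0 < a34" "a34 < a4"
    and "a3 > a32 + a34" "a34 < a24" "a12 \<le> a32"
    and "a2 \<le> a21 + a24"
    and "a3 + a13 \<le> a1 + a32 - a12 + a34"
  defines "G \<equiv> {Var 2 ^ a12 * Var 3 ^ a13, p2, Var 2 ^ a32 * Var 4 ^ a34,
                Var 4 ^ a4, Var 3 ^ a13 * Var 4 ^ a24, p6}"
  shows "minimally_generates G (initial_ideal I) \<and> card G = 6"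
proof -
  have n_pos: "0 < n i" for i
    using exhaust_4 [of i] assms(9-12) by auto
  have f_xm: "f1 = xm (expo a1 0 0 0) - xm (expo 0 a12 a13 0)"
    "f2 = xm (expo 0 a2 0 0) - xm (expo a21 0 0 a24)"
    "f3 = xm (expo 0 0 a3 0) - xm (expo 0 a32 0 a34)"
    "f4 = xm (expo 0 0 0 a4) - xm (expo a41 0 a43 0)"
    "f5 = xm (expo a41 a32 0 0) - xm (expo 0 0 a13 a24)"
    unfolding f1_def f2_def f3_def f4_def f5_def
    by (simp_all add: Var_power_expo mult_single expo_add)
  have gen: "ideal_gen {f1, f2, f3, f4, f5} = curve_ideal n"
    using \<open>minimally_generates {f1, f2, f3, f4, f5} I\<close> by (simp add: minimally_generates_def I_def)
  then have "{f1, f2, f3, f4, f5} \<subseteq> curve_ideal n"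
    using ideal_gen_superset [of "{f1, f2, f3, f4, f5}"] by simp
  then have weights: "a1 * n 1 = a12 * n 2 + a13 * n 3" "a2 * n 2 = a21 * n 1 + a24 * n 4"
    "a3 * n 3 = a32 * n 2 + a34 * n 4" "a4 * n 4 = a41 * n 1 + a43 * n 3"
    "a41 * n 1 + a32 * n 2 = a13 * n 3 + a24 * n 4"
    unfolding f_xm by (simp_all add: binomial_in_curve_ideal)
  interpret gorenstein_exponents n a1 a2 a3 a4 a12 a13 a21 a24 a32 a34 a41 a43
  proof
    fix a b c d a' b' c' d'
    assume w: "a * n 1 + b * n 2 + c * n 3 + d * n 4 = a' * n 1 + b' * n 2 + c' * n 3 + d' * n 4"
      and ne: "(a, b, c, d) \<noteq> (a', b', c', d')"
    let ?f = "xm (expo a b c d) - xm (expo a' b' c' d') :: 'k poly4"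
    have "?f \<in> ideal_gen {f1, f2, f3, f4, f5}"
      using w by (simp add: gen binomial_in_curve_ideal)
    moreover have "expo a b c d \<in> Poly_Mapping.keys ?f"
      using ne by (subst keys_binomial) auto
    ultimately obtain g e e' where g: "g \<in> {f1, f2, f3, f4, f5}" "e \<in> Poly_Mapping.keys g"
      and "expo a b c d = e + e'"
      by (rule keys_ideal_gen)
    then have "mono_dvd e (expo a b c d)" by (auto simp: mono_dvd_def)
    moreover have "e \<in> {expo a1 0 0 0, expo 0 a12 a13 0, expo 0 a2 0 0, expo a21 0 0 a24,
        expo 0 0 a3 0, expo 0 a32 0 a34, expo 0 0 0 a4, expo a41 0 a43 0, expo a41 a32 0 0,
        expo 0 0 a13 a24}"
      using g \<open>0 < a12\<close> \<open>0 < a21\<close> \<open>0 < a32\<close> \<open>0 < a41\<close> \<open>0 < a13\<close>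
      unfolding f_xm by (auto simp: keys_binomial)
    ultimately show "a1 \<le> a \<or> a12 \<le> b \<and> a13 \<le> c \<or> a2 \<le> b \<or> a21 \<le> a \<and> a24 \<le> d \<or> a3 \<le> c \<or>
        a32 \<le> b \<and> a34 \<le> d \<or> a4 \<le> d \<or> a41 \<le> a \<and> a43 \<le> c \<or> a41 \<le> a \<and> a32 \<le> b \<or> a13 \<le> c \<and> a24 \<le> d"
      by - (elim insertE emptyE, simp_all)
  qed (fact n_pos weights assms)+

  \<comment> \<open>The rules of \<open>f1\<close>, \<open>f3\<close> and \<open>f5\<close> are read
    from right to left. The sixth is x_3^a13 f_3 - x_2^(a32-a12) x_4^a34 f_1.\<close>
  define S where "S = {(expo 0 a12 a13 0, expo a1 0 0 0), (expo 0 a2 0 0, expo a21 0 0 a24),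
    (expo 0 a32 0 a34, expo 0 0 a3 0), (expo 0 0 0 a4, expo a41 0 a43 0),
    (expo 0 0 a13 a24, expo a41 a32 0 0), (expo 0 0 (a3 + a13) 0, expo a1 (a32 - a12) 0 a34)}"
  \<comment> \<open>A monomial in the heavier variables needs a smaller degree to reach the same
    weight.\<close>
  have deg1: "a12 + a13 < a1"
  proof -
    have "(a12 + a13) * n 1 < a12 * n 2 + a13 * n 3"
      unfolding add_mult_distrib using assms(9-12) bounds
      by (intro add_strict_mono mult_strict_left_mono) auto
    then show ?thesis using weights(1) by (metis mult_less_cancel2)
  qed
  have deg4: "a4 < a41 + a43"
  proof -
    have "a41 * n 1 + a43 * n 3 < (a41 + a43) * n 4"
      unfolding add_mult_distrib using assms(9-12) bounds
      by (intro add_strict_mono mult_strict_left_mono) auto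
    then show ?thesis using weights(4) by (metis mult_less_cancel2)
  qed
  \<comment> \<open>Here \<open>n 3\<close> separates the weights: x_1 and x_2 are lighter, x_3 and
    x_4 are not.\<close>
  have deg5: "a13 + a24 < a41 + a32"
  proof -
    have "(a13 + a24) * n 3 < a13 * n 3 + a24 * n 4"
      unfolding add_mult_distrib using assms(9-12) bounds by simp
    also have "\<dots> < (a41 + a32) * n 3"
      unfolding add_mult_distrib weights(5) [symmetric] using assms(9-12) bounds
      by (intro add_strict_mono mult_strict_left_mono) auto
    finally show ?thesis by simp
  qed
  have deg6: "a3 + a13 \<le> a1 + (a32 - a12) + a34"
    using \<open>a3 + a13 \<le> a1 + a32 - a12 + a34\<close> \<open>a12 \<le> a32\<close> by simp
  have weight6: "(a3 + a13) * n 3 = a1 * n 1 + (a32 - a12) * n 2 + a34 * n 4"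
    using weights(1,3) mult_le_mono1 [OF \<open>a12 \<le> a32\<close>, of "n 2"]
    by (simp add: add_mult_distrib diff_mult_distrib)

  \<comment> \<open>Four rules raise the degree strictly. Those of \<open>p2\<close> and
    \<open>p6\<close> may keep it, but they introduce x_1, which the added exponent of x_1
    records.\<close>
  have S_weight: "weight n u = weight n v"
    and S_degree: "total_degree u \<le> total_degree v"
    and S_increasing: "total_degree u + Poly_Mapping.lookup u 1
      < total_degree v + Poly_Mapping.lookup v 1" if "(u, v) \<in> S" for u v
    using that weights weight6 deg1 \<open>a2 \<le> a21 + a24\<close> \<open>a3 > a32 + a34\<close> deg4 deg5 deg6 bounds
    unfolding S_def by auto
  have S_unique: "u = v" if "weight n u = weight n v" "\<forall>(l, r) \<in> S. \<not> mono_dvd l u"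
    "\<forall>(l, r) \<in> S. \<not> mono_dvd l v" for u v
  proof -
    obtain a b c d where u: "u = expo a b c d" by (rule expo_cases)
    obtain a' b' c' d' where v: "v = expo a' b' c' d'" by (rule expo_cases)
    have "standard b c d" "standard b' c' d'"
      using that(2,3) unfolding u v S_def standard_def by auto
    from standard_unique [OF \<open>a12 \<le> a32\<close> this] show ?thesis
      using that(1) unfolding u v by simp
  qed
  \<comment> \<open>The only right-hand side dividing another rule's left-hand side is x_3^a3, a
    divisor of x_3^(a3+a13); its rule raises the degree since \<open>a3 > a32 + a34\<close>.\<close>
  have S_indep: "\<not> mono_dvd u' u \<and> (mono_dvd v' u \<longrightarrow> total_degree u' < total_degree v')"
    if "(u, v) \<in> S" "(u', v') \<in> S" "(u, v) \<noteq> (u', v')" for u v u' v'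
    using that bounds \<open>a3 > a32 + a34\<close> unfolding S_def
    by (elim insertE emptyE) simp_all
  have S_ne: "u \<noteq> v" if "(u, v) \<in> S" for u v
    using S_increasing [OF that] by blast

  have p2: "p2 = lead_form (expo 0 a2 0 0, expo a21 0 0 a24)"
    unfolding p2_def by (simp add: lead_form_def Var_power_expo mult_single expo_add)
  have p6: "p6 = lead_form (expo 0 0 (a3 + a13) 0, expo a1 (a32 - a12) 0 a34)"
    unfolding p6_def using \<open>a12 \<le> a32\<close>
    by (simp add: lead_form_def Var_power_expo mult_single expo_add)
  have G: "G = lead_form ` S"
    unfolding G_def S_def p2 p6
    using deg1 deg4 deg5 \<open>a3 > a32 + a34\<close>
    by (simp add: lead_form_def Var_power_expo mult_single expo_add)

  have "ideal_gen G = initial_ideal I"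
    unfolding G I_def using n_pos S_weight S_degree S_increasing S_unique
    by (rule initial_ideal_curve_eq)
  moreover have "minimally_generates G (ideal_gen G)"
    unfolding G using S_ne S_indep by (rule minimally_generates_lead_form)
  moreover have "card G = card S"
    unfolding G by (rule card_image, rule inj_on_lead_form) (fact S_ne S_indep)+
  moreover have "card S = 6"
    unfolding S_def using bounds by simp
  ultimately show ?thesis by simp
qed

end
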